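(* For any (finite, nonempty) poset $P$, either there exists a constant $K_P$ such that $\mathrm{sat}^*(n,P)\leq K_P$ for all $n\in\mathbb N$, or $\mathrm{sat}^*(n,P)\geq \min\{2\sqrt n,\ n/2+1\}$ for all $n\in\mathbb N$.
   Context: $\mathbb N=\{1,2,\dots\}$ and $[n]=\{1,\dots,n\}$. All posets are viewed as finite collections of finite subsets of $\mathbb N$, ordered by inclusion (posets $P$ are taken nonempty). A poset $P$ is an induced subposet of a poset $Q$ (equivalently, $Q$ contains an induced copy of $P$) if there is an injective map $\phi:P\to Q$ such that for all $A,B\in P$, $\phi(A)\subseteq\phi(B)$ if and only if $A\subseteq B$; otherwise $Q$ is induced $P$-free. A family $\mathcal F\subseteq 2^{[n]}$ is induced $P$-saturated if $\mathcal F$ is induced $P$-free, but for every $S\subseteq[n]$ with $S\notin\mathcal F$, $P$ is an induced subposet of $\mathcal F\cup\{S\}$. $\mathrm{sat}^*(n,P)$ denotes the size of the smallest induced $P$-saturated family $\mathcal F\subseteq 2^{[n]}$. *)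

theory Defs
  imports Complex_Main
begin

text \<open>Posets are finite collections of finite subsets of \<open>{1, 2, \<dots>}\<close>, ordered by inclusion;
  \<open>\<nat>\<close> starts at 1 throughout.\<close>

definition set_poset :: "nat set set \<Rightarrow> bool" where
  "set_poset P \<longleftrightarrow> P \<noteq> {} \<and> finite P \<and> (\<forall>A\<in>P. finite A \<and> A \<subseteq> {1..})"

definition induced_subposet :: "nat set set \<Rightarrow> nat set set \<Rightarrow> bool" where
  "induced_subposet P Q \<longleftrightarrow>
     (\<exists>\<phi>. inj_on \<phi> P \<and> \<phi> ` P \<subseteq> Q \<and> (\<forall>A\<in>P. \<forall>B\<in>P. \<phi> A \<subseteq> \<phi> B \<longleftrightarrow> A \<subseteq> B))"

abbreviation induced_free :: "nat set set \<Rightarrow> nat set set \<Rightarrow> bool" where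
  "induced_free P Q \<equiv> \<not> induced_subposet P Q"

definition induced_saturated :: "nat \<Rightarrow> nat set set \<Rightarrow> nat set set \<Rightarrow> bool" where
  "induced_saturated n P F \<longleftrightarrow>
     F \<subseteq> Pow {1..n} \<and> induced_free P F \<and>
     (\<forall>S. S \<subseteq> {1..n} \<and> S \<notin> F \<longrightarrow> induced_subposet P (F \<union> {S}))"

definition sat_star :: "nat \<Rightarrow> nat set set \<Rightarrow> nat" where
  "sat_star n P = (LEAST k. \<exists>F. induced_saturated n P F \<and> card F = k)"

text \<open>The minimum is attained: nonempty posets admit saturated families.\<close>

lemma induced_saturated_exists:
  assumes "P \<noteq> {}"
  shows "\<exists>F. induced_saturated n P F"
proof -
  let ?\<A> = "{F. F \<subseteq> Pow {1..n} \<and> induced_free P F}"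
  have "finite ?\<A>"
    by (rule finite_subset[of _ "Pow (Pow {1..n})"]) auto
  moreover have "{} \<in> ?\<A>"
    using assms by (simp add: induced_subposet_def)
  ultimately have "\<exists>F\<in>?\<A>. \<forall>G\<in>?\<A>. F \<subseteq> G \<longrightarrow> F = G"
    by (intro finite_has_maximal) blast+
  then obtain F where F: "F \<in> ?\<A>" and max: "\<forall>G\<in>?\<A>. F \<subseteq> G \<longrightarrow> F = G" ..
  have "induced_subposet P (F \<union> {S})" if "S \<subseteq> {1..n}" "S \<notin> F" for S
  proof (rule ccontr)
    assume "\<not> induced_subposet P (F \<union> {S})"
    then have "F \<union> {S} \<in> ?\<A>" using F that(1) by simp
    from bspec[OF max this] have "F = F \<union> {S}" by (rule mp) (rule Un_upper1)
    then have "S \<in> F" by (rule ssubst) simp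
    with that(2) show False ..
  qed
  with F have "induced_saturated n P F"
    by (simp add: induced_saturated_def)
  then show ?thesis ..
qed

lemma sat_star_attained:
  assumes "P \<noteq> {}"
  shows "\<exists>F. induced_saturated n P F \<and> card F = sat_star n P"
  unfolding sat_star_def
proof (rule LeastI_ex)
  show "\<exists>k F. induced_saturated n P F \<and> card F = k"
    using induced_saturated_exists[OF assms, of n] by simp
qed

end

theory Submission
  imports Defs
begin

text \<open>
  Let \<open>F\<close> be a saturated family on \<open>{1..n}\<close>. If some \<open>i\<close> is not of the form \<open>A - B = {i}\<close> with
  \<open>A, B \<in> F\<close>, then replacing \<open>i\<close> by a block of arbitrarily many twins keeps the family saturated:
  a new set that cuts the block compares with the family either like its version without the block
  or like its version with the whole block, since otherwise there would be \<open>A, B \<in> F\<close> with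
  \<open>A - B = {i}\<close>. Hence the saturation number is bounded.

  Otherwise, choosing for every \<open>i\<close> an edge from \<open>A\<close> to \<open>B\<close> with \<open>A - B = {i}\<close> yields a digraph
  on \<open>F\<close> with \<open>n\<close> edges. It has no edge whose ends are joined by another directed path,
  because \<open>i \<in> A\<close> survives along every edge with a label different from \<open>i\<close>. If such a digraph
  has \<open>m\<close> vertices and \<open>q\<close> strong components, it has at most \<open>2 (m - q)\<close> edges inside the
  components (they lie on an in-tree or an out-tree of a root), and by Mantel's theorem at most
  \<open>q\<^sup>2 / 4\<close> edges between them.
\<close>

section \<open>Blowing up an element\<close>

text \<open>Copies of \<open>P\<close> are carried along any order embedding; injectivity comes for
  free from antisymmetry of inclusion.\<close>

lemma induced_subposet_embed:
  assumes "induced_subposet P Q"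
    and "g ` Q \<subseteq> R"
    and "\<And>X Y. X \<in> Q \<Longrightarrow> Y \<in> Q \<Longrightarrow> g X \<subseteq> g Y \<longleftrightarrow> X \<subseteq> Y"
  shows "induced_subposet P R"
proof -
  obtain \<phi> where \<phi>: "\<phi> ` P \<subseteq> Q" "\<forall>A\<in>P. \<forall>B\<in>P. \<phi> A \<subseteq> \<phi> B \<longleftrightarrow> A \<subseteq> B"
    using assms(1) unfolding induced_subposet_def by blast
  have emb: "g (\<phi> A) \<subseteq> g (\<phi> B) \<longleftrightarrow> A \<subseteq> B" if "A \<in> P" "B \<in> P" for A B
  proof -
    have "\<phi> A \<in> Q" "\<phi> B \<in> Q"
      using that \<phi>(1) by auto
    then show ?thesis
      using assms(3) \<phi>(2) that by simp
  qed
  have "inj_on (g \<circ> \<phi>) P"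
  proof (rule inj_onI)
    fix A B assume "A \<in> P" "B \<in> P" "(g \<circ> \<phi>) A = (g \<circ> \<phi>) B"
    then show "A = B"
      using emb[of A B] emb[of B A] by auto
  qed
  moreover have "(g \<circ> \<phi>) ` P \<subseteq> R"
    using \<phi>(1) assms(2) by auto
  ultimately show ?thesis
    using emb unfolding induced_subposet_def by (intro exI[of _ "g \<circ> \<phi>"]) simp
qed

definition blow_up :: "'a \<Rightarrow> 'a set \<Rightarrow> 'a set \<Rightarrow> 'a set" where
  "blow_up i J A = (if i \<in> A then A \<union> J else A)"

lemma blow_up_subset_iff:
  assumes "A \<inter> J = {}" "B \<inter> J = {}"
  shows "blow_up i J A \<subseteq> blow_up i J B \<longleftrightarrow> A \<subseteq> B"
  using assms by (auto simp: blow_up_def)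

text \<open>Blowing up preserves and reflects inclusion, so freeness transfers. For a new set
  \<open>S\<close> it suffices to find \<open>T\<close> outside \<open>F\<close> that compares with
  \<open>F\<close> as \<open>S\<close> does with the blown-up family: \<open>T\<close> is then
  replaced by \<open>S\<close> in a copy of \<open>P\<close> (the fact
  \<open>extend\<close>).\<close>

lemma induced_saturated_blow_up:
  assumes sat: "induced_saturated n P F"
    and i: "i \<in> {1..n}"
    and nodiff: "\<And>A B. A \<in> F \<Longrightarrow> B \<in> F \<Longrightarrow> A - B \<noteq> {i}"
    and "n \<le> N"
  shows "induced_saturated N P (blow_up i {n<..N} ` F)"
proof -
  define J where "J = {n<..N}"
  let ?g = "blow_up i J"
  have F: "F \<subseteq> Pow {1..n}" and free: "\<not> induced_subposet P F"
    and add: "\<And>S. S \<subseteq> {1..n} \<Longrightarrow> S \<notin> F \<Longrightarrow> induced_subposet P (insert S F)"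
    using sat unfolding induced_saturated_def by auto
  have disj: "A \<inter> J = {}" if "A \<subseteq> {1..n}" for A
    using that by (auto simp: J_def)
  have FJ: "A \<inter> J = {}" if "A \<in> F" for A
    using F disj that by auto
  have iJ: "i \<notin> J"
    using i by (auto simp: J_def)
  have g_iff: "?g A \<subseteq> ?g B \<longleftrightarrow> A \<subseteq> B" if "A \<subseteq> {1..n}" "B \<subseteq> {1..n}" for A B
    using blow_up_subset_iff disj that by metis
  have g_inj: "A = B" if "A \<subseteq> {1..n}" "B \<subseteq> {1..n}" "?g A = ?g B" for A B
    using g_iff[of A B] g_iff[of B A] that by auto
  have sub: "?g ` F \<subseteq> Pow {1..N}"
  proof clarify
    fix A x assume "A \<in> F" "x \<in> ?g A"
    then have "x \<in> {1..n} \<union> J"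
      using F unfolding blow_up_def by (fastforce split: if_splits)
    then show "x \<in> {1..N}"
      using \<open>n \<le> N\<close> by (auto simp: J_def)
  qed
  have free': "\<not> induced_subposet P (?g ` F)"
  proof
    assume "induced_subposet P (?g ` F)"
    \<comment> \<open>Deleting \<open>J\<close> undoes the blow-up and loses no inclusion, because
      every blown-up set treats \<open>J\<close> exactly as it treats \<open>i\<close>.\<close>
    then have "induced_subposet P F"
    proof (rule induced_subposet_embed)
      show "(\<lambda>A. A - J) ` ?g ` F \<subseteq> F"
      proof clarsimp
        fix A assume "A \<in> F"
        moreover have "?g A - J = A"
          using FJ[OF \<open>A \<in> F\<close>] by (auto simp: blow_up_def)
        ultimately show "?g A - J \<in> F" by simp
      qed
    next
      fix X Y assume "X \<in> ?g ` F" "Y \<in> ?g ` F"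
      then show "X - J \<subseteq> Y - J \<longleftrightarrow> X \<subseteq> Y"
        using FJ iJ by (auto simp: blow_up_def)
    qed
    with free show False ..
  qed
  have extend: "induced_subposet P (insert S (?g ` F))"
    if T: "T \<subseteq> {1..n}" "T \<notin> F"
      and below: "\<And>A. A \<in> F \<Longrightarrow> ?g A \<subseteq> S \<longleftrightarrow> A \<subseteq> T"
      and above: "\<And>A. A \<in> F \<Longrightarrow> S \<subseteq> ?g A \<longleftrightarrow> T \<subseteq> A"
    for S T
  proof (rule induced_subposet_embed[OF add[OF T]])
    let ?h = "\<lambda>A. if A = T then S else ?g A"
    show "?h ` insert T F \<subseteq> insert S (?g ` F)" by auto
    fix X Y assume "X \<in> insert T F" "Y \<in> insert T F"
    then consider "X = T" "Y = T" | "X = T" "Y \<in> F" "Y \<noteq> T" | "X \<in> F" "X \<noteq> T" "Y = T"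
      | "X \<in> F" "Y \<in> F" "X \<noteq> T" "Y \<noteq> T"
      by auto
    then show "?h X \<subseteq> ?h Y \<longleftrightarrow> X \<subseteq> Y"
    proof cases
      case 4
      then have "X \<subseteq> {1..n}" "Y \<subseteq> {1..n}" using F by auto
      with 4 show ?thesis using g_iff by simp
    qed (simp_all add: below above)
  qed
  have new: "induced_subposet P (insert S (?g ` F))" if S: "S \<subseteq> {1..N}" "S \<notin> ?g ` F" for S
  \<comment> \<open>The split is whether \<open>S\<close> cuts the block \<open>insert i J\<close>.
    If it does not, \<open>S\<close> is itself the blow-up of \<open>S - J\<close>.\<close>
  proof (cases "(\<exists>x\<in>insert i J. x \<in> S) \<and> (\<exists>x\<in>insert i J. x \<notin> S)")
    case False
    let ?T = "S - J"
    have T: "?T \<subseteq> {1..n}"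
      using S(1) by (auto simp: J_def)
    have gT: "?g ?T = S"
      using False iJ by (auto simp: blow_up_def)
    have "?T \<notin> F"
      using S(2) gT by (metis imageI)
    then show ?thesis
    proof (rule extend[OF T])
      fix A assume "A \<in> F"
      then have "A \<subseteq> {1..n}" using F by auto
      then show "?g A \<subseteq> S \<longleftrightarrow> A \<subseteq> ?T" "S \<subseteq> ?g A \<longleftrightarrow> ?T \<subseteq> A"
        using g_iff[of A ?T] g_iff[of ?T A] T gT by auto
    qed
  next
    case True
    define T where "T = S - insert i J"
    have T: "T \<subseteq> {1..n}"
      using S(1) by (auto simp: J_def T_def)
    \<comment> \<open>A blown-up set contains the whole block or misses it, so below a cutting
      \<open>S\<close> it must miss it and above \<open>S\<close> it must contain it.\<close>
    have below: "?g A \<subseteq> S \<longleftrightarrow> i \<notin> A \<and> A \<subseteq> T" if "A \<in> F" for A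
      using FJ[OF that] True by (auto simp: blow_up_def T_def)
    have above: "S \<subseteq> ?g A \<longleftrightarrow> i \<in> A \<and> T \<subseteq> A" if "A \<in> F" for A
      using FJ[OF that] True by (auto simp: blow_up_def T_def)
    have iT: "i \<notin> T" by (simp add: T_def)
    show ?thesis
    \<comment> \<open>If no such \<open>B\<close> exists, every member above \<open>T\<close>
      contains \<open>i\<close>, so \<open>T\<close> imitates \<open>S\<close>. Otherwise a member
      \<open>A\<close> with \<open>i\<close> and inside \<open>insert i T\<close> would give
      \<open>A - B = {i}\<close>; hence there is none, and \<open>insert i T\<close> imitates
      \<open>S\<close>.\<close>
    proof (cases "\<exists>B\<in>F. i \<notin> B \<and> T \<subseteq> B")
      case False
      show ?thesis
        by (rule extend[OF T]) (use False iT below above in auto)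
    next
      case True
      then obtain B where B: "B \<in> F" "i \<notin> B" "T \<subseteq> B" by auto
      have no: "\<not> A \<subseteq> insert i T" if "A \<in> F" "i \<in> A" for A
        using nodiff[OF that(1) B(1)] that(2) B(2,3) by auto
      have iT': "insert i T \<subseteq> {1..n}" using T i by auto
      show ?thesis
      proof (rule extend[OF iT'])
        fix A assume A: "A \<in> F"
        show "?g A \<subseteq> S \<longleftrightarrow> A \<subseteq> insert i T"
          using no[OF A] below[OF A] iT by auto
        show "S \<subseteq> ?g A \<longleftrightarrow> insert i T \<subseteq> A"
          using above[OF A] by auto
      qed (use no in auto)
    qed
  qed
  show ?thesis
    using sub free' new unfolding induced_saturated_def J_def by auto
qed

section \<open>Boundedness of the saturation number\<close>

lemma sat_star_le:
  assumes "induced_saturated n P F"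
  shows "sat_star n P \<le> card F"
  unfolding sat_star_def using assms by (intro Least_le) auto

lemma sat_star_bounded:
  assumes sat: "induced_saturated n P F" and "i \<in> {1..n}"
    and "\<And>A B. A \<in> F \<Longrightarrow> B \<in> F \<Longrightarrow> A - B \<noteq> {i}"
  shows "\<exists>K. \<forall>N. sat_star N P \<le> K"
proof (intro exI allI)
  fix N
  have finF: "finite F"
    using sat finite_subset unfolding induced_saturated_def by blast
  \<comment> \<open>The blow-up requires \<open>n \<le> N\<close>; the sum absorbs the finitely many
    smaller \<open>N\<close>.\<close>
  show "sat_star N P \<le> card F + (\<Sum>k<n. sat_star k P)"
  proof (cases "N < n")
    case True
    then have "sat_star N P \<le> (\<Sum>k<n. sat_star k P)"
      by (intro member_le_sum) auto
    then show ?thesis by simp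
  next
    case False
    then have "sat_star N P \<le> card (blow_up i {n<..N} ` F)"
      using assms by (intro sat_star_le induced_saturated_blow_up) auto
    also have "\<dots> \<le> card F"
      by (rule card_image_le[OF finF])
    finally show ?thesis by simp
  qed
qed

section \<open>Digraphs without redundant edges\<close>

text \<open>Induction by deleting both ends of an edge. Asymmetry makes each edge of the underlying
  undirected graph count once.\<close>

lemma mantel:
  assumes "finite V" "E \<subseteq> V \<times> V"
    and "asym E"
    and "\<And>a b c. {(a, b), (b, a)} \<inter> E \<noteq> {} \<Longrightarrow> {(b, c), (c, b)} \<inter> E \<noteq> {} \<Longrightarrow>
           {(a, c), (c, a)} \<inter> E \<noteq> {} \<Longrightarrow> False"
  shows "4 * card E \<le> (card V)\<^sup>2"
  using assms
proof (induction "card V" arbitrary: V E rule: less_induct)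
  case less
  note E = less.prems(2) and as = asymD[OF less.prems(3)] and tri = less.prems(4)
  show ?case
  proof (cases "E = {}")
    case False
    then obtain a b where ab: "(a, b) \<in> E" by auto
    have V: "a \<in> V" "b \<in> V" "a \<noteq> b"
      using ab E as by auto
    define W where "W = V - {a, b}"
    define D where "D = E \<inter> W \<times> W"
    have finE: "finite E"
      using E less.prems(1) finite_subset by blast
    have finW: "finite W"
      using less.prems(1) by (simp add: W_def)
    have cV: "card V = card W + 2"
    proof -
      have "V = insert a (insert b W)" using V by (auto simp: W_def)
      moreover have "a \<notin> insert b W" "b \<notin> W" using V by (auto simp: W_def)
      ultimately show ?thesis using finW by simp
    qed
    have IH: "4 * card D \<le> (card W)\<^sup>2"
    proof (rule less.hyps)
      show "asym D"
        using as by (auto simp: D_def intro!: asymI)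
    next
      fix x y z
      assume "{(x, y), (y, x)} \<inter> D \<noteq> {}" "{(y, z), (z, y)} \<inter> D \<noteq> {}" "{(x, z), (z, x)} \<inter> D \<noteq> {}"
      then show False
        using tri[of x y z] unfolding D_def by blast
    qed (use cV finW in \<open>auto simp: D_def\<close>)
    \<comment> \<open>An edge leaving \<open>{a, b}\<close> is sent to its outer end; this is
      injective since a vertex joined to both \<open>a\<close> and \<open>b\<close> would close a
      triangle.\<close>
    let ?f = "\<lambda>(x, y). if x \<in> {a, b} then y else x"
    have "card (E - D - {(a, b)}) \<le> card W"
    proof (rule card_inj_on_le[OF _ _ finW])
      have other: "(x \<in> {a, b} \<and> y \<in> W) \<or> (x \<in> W \<and> y \<in> {a, b})"
        if "(x, y) \<in> E - D - {(a, b)}" for x y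
        using that E ab as[of a b] as[of x x] by (auto simp: D_def W_def)
      then show "?f ` (E - D - {(a, b)}) \<subseteq> W"
        by (fastforce simp: W_def)
      show "inj_on ?f (E - D - {(a, b)})"
      proof (rule inj_onI)
        fix p p'
        assume p: "p \<in> E - D - {(a, b)}" "p' \<in> E - D - {(a, b)}" "?f p = ?f p'"
        obtain x y x' y' where pairs: "p = (x, y)" "p' = (x', y')"
          by (cases p, cases p')
        have e: "(x, y) \<in> E" "(x, y) \<notin> D" "(x, y) \<noteq> (a, b)"
          and e': "(x', y') \<in> E" "(x', y') \<notin> D" "(x', y') \<noteq> (a, b)"
          and eq: "(if x \<in> {a, b} then y else x) = (if x' \<in> {a, b} then y' else x')"
          using p by (simp_all add: pairs)
        define w where "w = (if x \<in> {a, b} then y else x)"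
        have w: "w \<in> W" "w \<notin> {a, b}"
          using other[of x y] e by (auto simp: w_def W_def)
        have o: "\<exists>c\<in>{a, b}. (x, y) \<in> {(c, w), (w, c)}"
          using other[of x y] e by (auto simp: w_def W_def)
        have o': "\<exists>c\<in>{a, b}. (x', y') \<in> {(c, w), (w, c)}"
          using other[of x' y'] e' eq by (auto simp: w_def W_def)
        from o obtain c where c: "c \<in> {a, b}" "(x, y) \<in> {(c, w), (w, c)}" by blast
        from o' obtain c' where c': "c' \<in> {a, b}" "(x', y') \<in> {(c', w), (w, c')}" by blast
        have "c = c'"
        proof (rule ccontr)
          assume "c \<noteq> c'"
          then have "{(c, c'), (c', c)} \<inter> E \<noteq> {}"
            using c(1) c'(1) ab by auto
          moreover have "{(c', w), (w, c')} \<inter> E \<noteq> {}" "{(c, w), (w, c)} \<inter> E \<noteq> {}"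
            using c(2) c'(2) e e' by auto
          ultimately show False by (rule tri)
        qed
        then show "p = p'"
          using c(2) c'(2) e(1) e'(1) as[of c w] as[of w c] by (auto simp: pairs)
      qed
    qed
    moreover have "card E \<le> card (E - D - {(a, b)}) + card D + 1"
    proof -
      have "E = (E - D - {(a, b)}) \<union> D \<union> {(a, b)}"
        using ab by (auto simp: D_def)
      then have "card E \<le> card ((E - D - {(a, b)}) \<union> D) + card {(a, b)}"
        by (metis card_Un_le)
      also have "\<dots> \<le> card (E - D - {(a, b)}) + card D + 1"
        using card_Un_le[of "E - D - {(a, b)}" D] by simp
      finally show ?thesis .
    qed
    ultimately have "4 * card E \<le> 4 * card W + (card W)\<^sup>2 + 4"
      using IH by linarith
    then show ?thesis
      by (simp add: cV power2_eq_square)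
  qed simp
qed

section \<open>Irredundant digraphs and their strong components\<close>

text \<open>Reflexivity of the closure makes every loop redundant as well.\<close>

definition irredundant :: "'a rel \<Rightarrow> bool" where
  "irredundant E \<longleftrightarrow> (\<forall>e\<in>E. e \<notin> (E - {e})\<^sup>*)"

lemma rtrancl_avoid_edge:
  assumes "(x, y) \<in> E\<^sup>*"
  shows "(x, y) \<in> (E - {(u, v)})\<^sup>* \<or> (x, u) \<in> E\<^sup>* \<and> (v, y) \<in> E\<^sup>*"
  using assms
proof (induction rule: rtrancl_induct)
  case (step y z)
  show ?case
  proof (cases "(y, z) = (u, v)")
    case True
    then show ?thesis using step by auto
  next
    case False
    then have "(y, z) \<in> E - {(u, v)}" using step by auto
    then show ?thesis
      using step by (meson rtrancl.rtrancl_into_rtrancl)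
  qed
qed simp

text \<open>Stop the walk at its first arrival in \<open>v\<close>. The part before that survives
  the deletion of any edge into \<open>v\<close>.\<close>

lemma rtrancl_last_edge:
  assumes "(r, v) \<in> E\<^sup>*" "r \<noteq> v"
  obtains w where "(w, v) \<in> E" "(r, w) \<in> {e \<in> E. snd e \<noteq> v}\<^sup>*"
proof -
  have "(r, y) \<in> {e \<in> E. snd e \<noteq> v}\<^sup>* \<or> (\<exists>w. (w, v) \<in> E \<and> (r, w) \<in> {e \<in> E. snd e \<noteq> v}\<^sup>*)"
    if "(r, y) \<in> E\<^sup>*" for y
    using that
  proof (induction rule: rtrancl_induct)
    case (step y z)
    then show ?case
      by (cases "z = v") (auto intro: rtrancl_into_rtrancl)
  qed simp
  from this[OF assms(1)] show thesis
  proof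
    assume "(r, v) \<in> {e \<in> E. snd e \<noteq> v}\<^sup>*"
    then show thesis
      using assms(2) by (cases rule: rtranclE) auto
  qed (use that in blast)
qed

text \<open>The edges that cannot be avoided on the way from the root of their component
  to their head form an out-forest.\<close>

lemma card_tree_edges_le:
  assumes "finite V" "E \<subseteq> V \<times> V"
    and root: "\<And>v. (r v, v) \<in> E\<^sup>*"
  shows "card {(u, v) \<in> E. (r v, v) \<notin> (E - {(u, v)})\<^sup>*} \<le> card {v \<in> V. r v \<noteq> v}"
proof (rule card_inj_on_le)
  let ?A = "{(u, v) \<in> E. (r v, v) \<notin> (E - {(u, v)})\<^sup>*}"
  show "snd ` ?A \<subseteq> {v \<in> V. r v \<noteq> v}"
  proof clarsimp
    fix u v assume "(u, v) \<in> E" "(r v, v) \<notin> (E - {(u, v)})\<^sup>*"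
    then show "v \<in> V \<and> r v \<noteq> v"
      using assms(2) rtrancl.rtrancl_refl[of v] by fastforce
  qed
  show "inj_on snd ?A"
  proof (rule inj_onI)
    \<comment> \<open>Fix one walk from the root whose last edge is \<open>(w, v)\<close>. Deleting
      any other edge into \<open>v\<close> leaves this walk intact, so only \<open>(w, v)\<close>
      can be unavoidable.\<close>
    have unique: "\<exists>w. \<forall>u. (u, v) \<in> ?A \<longrightarrow> u = w" for v
    proof (cases "r v = v")
      case True
      then show ?thesis by auto
    next
      case False
      obtain w where w: "(w, v) \<in> E" "(r v, w) \<in> {e \<in> E. snd e \<noteq> v}\<^sup>*"
        using rtrancl_last_edge[OF root False] .
      have "u = w" if "(u, v) \<in> ?A" for u
      proof (rule ccontr)
        assume "u \<noteq> w"
        then have "(w, v) \<in> E - {(u, v)}" using w(1) by auto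
        moreover have "(r v, w) \<in> (E - {(u, v)})\<^sup>*"
          using w(2) by (rule rtrancl_mono[THEN subsetD, rotated]) auto
        ultimately show False
          using that by (auto dest: rtrancl_into_rtrancl)
      qed
      then show ?thesis by blast
    qed
    fix e e' assume "e \<in> ?A" "e' \<in> ?A" "snd e = snd e'"
    then show "e = e'"
      using unique[of "snd e"] by (cases e, cases e') (simp, metis)
  qed
  show "finite {v \<in> V. r v \<noteq> v}" using assms(1) by simp
qed

text \<open>Here \<open>q\<close> counts the strong components. Edges inside them contribute at most
  \<open>2 * (card V - q)\<close>, edges between them at most a quarter of the square of
  \<open>q\<close>.\<close>

lemma card_irredundant_le:
  assumes fin: "finite V" and E: "E \<subseteq> V \<times> V" and irr: "irredundant E" and "V \<noteq> {}"
  obtains q where "1 \<le> q" "q \<le> card V" "4 * card E \<le> 8 * (card V - q) + q\<^sup>2"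
proof -
  \<comment> \<open>Vertices of one component satisfy the same predicate, so \<open>SOME\<close>
    picks the same root for all of them.\<close>
  define r where "r v = (SOME w. (v, w) \<in> E\<^sup>* \<and> (w, v) \<in> E\<^sup>*)" for v
  have r: "(v, r v) \<in> E\<^sup>*" "(r v, v) \<in> E\<^sup>*" for v
    using someI[of "\<lambda>w. (v, w) \<in> E\<^sup>* \<and> (w, v) \<in> E\<^sup>*" v] by (auto simp: r_def)
  have r_eq: "r u = r v \<longleftrightarrow> (u, v) \<in> E\<^sup>* \<and> (v, u) \<in> E\<^sup>*" for u v
  proof
    assume "r u = r v"
    then show "(u, v) \<in> E\<^sup>* \<and> (v, u) \<in> E\<^sup>*"
      using r[of u] r[of v] by (auto intro: rtrancl_trans)
  next
    assume "(u, v) \<in> E\<^sup>* \<and> (v, u) \<in> E\<^sup>*"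
    then have "(\<lambda>w. (u, w) \<in> E\<^sup>* \<and> (w, u) \<in> E\<^sup>*) = (\<lambda>w. (v, w) \<in> E\<^sup>* \<and> (w, v) \<in> E\<^sup>*)"
      by (intro ext) (meson rtrancl_trans)
    then show "r u = r v" by (simp add: r_def)
  qed
  have rr: "r (r v) = r v" for v
    using r r_eq by blast
  have reach_r: "(r u, r v) \<in> E\<^sup>* \<longleftrightarrow> (u, v) \<in> E\<^sup>*" for u v
    using r by (meson rtrancl_trans)
  have rV: "r v \<in> V" if "v \<in> V" for v
    using r(1)[of v] that E by (cases rule: rtranclE) auto
  define q where "q = card (r ` V)"
  have nonroots: "card {v \<in> V. r v \<noteq> v} = card V - q"
  proof -
    have "r ` V = V - {v \<in> V. r v \<noteq> v}"
      using rV rr by (auto simp: image_iff) metis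
    then have "q = card V - card {v \<in> V. r v \<noteq> v}"
      unfolding q_def using fin by (simp add: card_Diff_subset)
    moreover have "card {v \<in> V. r v \<noteq> v} \<le> card V"
      using fin by (intro card_mono) auto
    ultimately show ?thesis by simp
  qed
  \<comment> \<open>\<open>A\<close>: edges unavoidable from the root to their head;
    \<open>B\<close>: edges unavoidable from their tail to the root; \<open>C\<close>: edges between
    components. The bound for \<open>B\<close> is that for \<open>A\<close> in the converse
    digraph.\<close>
  define A where "A = {(u, v) \<in> E. (r v, v) \<notin> (E - {(u, v)})\<^sup>*}"
  define B where "B = {(u, v) \<in> E. (u, r u) \<notin> (E - {(u, v)})\<^sup>*}"
  define C where "C = {(u, v) \<in> E. r u \<noteq> r v}"
  have finE: "finite E"
    using fin E finite_subset by blast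
  have "card A \<le> card V - q"
    using card_tree_edges_le[OF fin E, of r] r(2) nonroots by (simp add: A_def)
  moreover have "card B \<le> card V - q"
  proof -
    have conv: "E\<inverse> - {(v, u)} = (E - {(u, v)})\<inverse>" for u v
      by auto
    have "B\<inverse> = {(v, u) \<in> E\<inverse>. (r u, u) \<notin> (E\<inverse> - {(v, u)})\<^sup>*}"
      unfolding B_def conv by (auto simp: rtrancl_converse)
    moreover have "card {(v, u) \<in> E\<inverse>. (r u, u) \<notin> (E\<inverse> - {(v, u)})\<^sup>*} \<le> card {v \<in> V. r v \<noteq> v}"
      by (rule card_tree_edges_le[OF fin]) (use E r(1) in \<open>auto simp: rtrancl_converse\<close>)
    ultimately have "card (B\<inverse>) \<le> card V - q"
      using nonroots by (simp only:)
    then show ?thesis by simp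
  qed
  moreover have "4 * card C \<le> q\<^sup>2"
  proof -
    define D where "D = map_prod r r ` C"
    have avoid: "(x, y) \<in> (E - {(u, v)})\<^sup>*"
      if "(x, y) \<in> E\<^sup>*" "\<not> ((x, u) \<in> E\<^sup>* \<and> (v, y) \<in> E\<^sup>*)" for x y u v
      using rtrancl_avoid_edge that by metis
    \<comment> \<open>A walk from \<open>u\<close> to \<open>w\<close> through \<open>(u, v)\<close>
      would make \<open>w\<close> reachable from \<open>v\<close>; one from \<open>w\<close> to
      \<open>v\<close> through it would make \<open>u\<close> reachable from \<open>w\<close>. So
      the detour via \<open>w\<close> avoids the edge.\<close>
    have between: False
      if "(u, v) \<in> E" "(u, w) \<in> E\<^sup>*" "(w, v) \<in> E\<^sup>*" "(w, u) \<notin> E\<^sup>*" "(v, w) \<notin> E\<^sup>*" for u v w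
      using avoid[of u w u v] avoid[of w v u v] that irr unfolding irredundant_def
      by (meson rtrancl_trans)
    have D: "\<exists>u v. (u, v) \<in> E \<and> a = r u \<and> b = r v \<and> (v, u) \<notin> E\<^sup>*" if ab: "(a, b) \<in> D" for a b
    proof -
      obtain u v where "(u, v) \<in> E" "a = r u" "b = r v" "r u \<noteq> r v"
        using ab by (auto simp: D_def C_def)
      then show ?thesis using r_eq by blast
    qed
    have D_fwd: "(a, b) \<in> E\<^sup>*" and D_bwd: "(b, a) \<notin> E\<^sup>*" if "(a, b) \<in> D" for a b
      using D[OF that] reach_r by auto
    have no_transitive: False if abc: "(a, b) \<in> D" "(b, c) \<in> D" "(a, c) \<in> D" for a b c
    proof -
      obtain u v where uv: "(u, v) \<in> E" "a = r u" "c = r v"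
        using D[OF abc(3)] by auto
      have "b = r b" using D[OF abc(1)] rr by auto
      then show False
        using between[OF uv(1), of b] D_fwd D_bwd abc uv(2,3) reach_r by metis
    qed
    \<comment> \<open>Two edges joining the same components in the same direction bypass each other:
      walks inside a component never use an edge between components.\<close>
    have "inj_on (map_prod r r) C"
    proof (rule inj_onI, clarsimp)
      fix u v u' v'
      assume "(u, v) \<in> C" "(u', v') \<in> C" and eq: "r u = r u'" "r v = r v'"
      then have e: "(u, v) \<in> E" "(u', v') \<in> E" "(v, u) \<notin> E\<^sup>*"
        using r_eq by (auto simp: C_def)
      show "u = u' \<and> v = v'"
      proof (rule ccontr)
        assume "\<not> (u = u' \<and> v = v')"
        then have "(u', v') \<in> E - {(u, v)}" using e by auto
        moreover have "(u, u') \<in> (E - {(u, v)})\<^sup>*"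
          using avoid[of u u' u v] eq(1) e(3) r_eq by (meson rtrancl_trans)
        moreover have "(v', v) \<in> (E - {(u, v)})\<^sup>*"
          using avoid[of v' v u v] eq(2) e(3) r_eq by (meson rtrancl_trans)
        ultimately have "(u, v) \<in> (E - {(u, v)})\<^sup>*"
          by (meson rtrancl.rtrancl_into_rtrancl rtrancl_trans)
        with irr e(1) show False unfolding irredundant_def by blast
      qed
    qed
    then have "card C = card D" by (simp add: D_def card_image)
    also have "4 * card D \<le> (card (r ` V))\<^sup>2"
    proof (rule mantel)
      show "D \<subseteq> r ` V \<times> r ` V"
        using E by (auto simp: D_def C_def)
      show "asym D"
        using D_fwd D_bwd by (auto intro!: asymI)
    next
      fix a b c
      assume "{(a, b), (b, a)} \<inter> D \<noteq> {}" "{(b, c), (c, b)} \<inter> D \<noteq> {}" "{(a, c), (c, a)} \<inter> D \<noteq> {}"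
      \<comment> \<open>A triangle is cyclic or transitive; a cyclic one would merge its
        components.\<close>
      moreover have "\<not> ((x, y) \<in> D \<and> (y, z) \<in> D \<and> (z, x) \<in> D)" for x y z
        using D_fwd D_bwd by (meson rtrancl_trans)
      ultimately show False
        using no_transitive by blast
    qed (use fin in simp)
    finally show ?thesis by (simp add: q_def)
  qed
  moreover have "E \<subseteq> A \<union> B \<union> C"
  proof clarify
    fix u v assume e: "(u, v) \<in> E" "(u, v) \<notin> C" "(u, v) \<notin> B"
    show "(u, v) \<in> A"
    proof (rule ccontr)
      assume "(u, v) \<notin> A"
      \<comment> \<open>Outside \<open>A\<close> and \<open>B\<close>, the root gives a detour from
        \<open>u\<close> to \<open>v\<close>.\<close>
      then have "(u, v) \<in> (E - {(u, v)})\<^sup>*"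
        using e by (auto simp: A_def B_def C_def intro: rtrancl_trans)
      with irr e(1) show False unfolding irredundant_def by blast
    qed
  qed
  then have "card E \<le> card (A \<union> B \<union> C)"
    using finE by (intro card_mono) (auto simp: A_def B_def C_def intro: finite_subset[OF _ finE])
  then have "card E \<le> card A + card B + card C"
    using card_Un_le[of "A \<union> B" C] card_Un_le[of A B] by linarith
  ultimately have "4 * card E \<le> 8 * (card V - q) + q\<^sup>2"
    by linarith
  moreover have "1 \<le> q"
    using fin \<open>V \<noteq> {}\<close> by (simp add: q_def Suc_le_eq card_gt_0_iff)
  moreover have "q \<le> card V"
    using fin by (simp add: q_def card_image_le)
  ultimately show thesis using that by blast
qed

text \<open>The bound is convex in \<open>q\<close>, hence largest at \<open>q = 1\<close> or
  \<open>q = card V\<close>. At \<open>q = 1\<close> a surplus of 1 over a multiple of 4 is lost by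
  integrality.\<close>

lemma card_irredundant_bound:
  assumes "finite V" "E \<subseteq> V \<times> V" "irredundant E" "V \<noteq> {}"
  shows "card E \<le> 2 * (card V - 1) \<or> 4 * card E \<le> (card V)\<^sup>2"
proof -
  obtain q where q: "1 \<le> q" "q \<le> card V" "4 * card E \<le> 8 * (card V - q) + q\<^sup>2"
    using card_irredundant_le[OF assms] .
  obtain d where d: "card V = q + d"
    using q(2) le_Suc_ex by blast
  show ?thesis
  proof (cases "q \<le> 6")
    case True
    then have "q \<in> {1, 2, 3, 4, 5, 6}" using q(1) by auto
    then show ?thesis using q(3) d by auto
  next
    \<comment> \<open>Now \<open>8 * d\<close> is at most the excess of the square of
      \<open>q + d\<close> over that of \<open>q\<close>.\<close>
    case False
    have "8 * d \<le> 2 * q * d + d * d"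
    proof (cases d)
      case (Suc k)
      then have "8 \<le> 2 * q + d" using False by simp
      then have "8 * d \<le> (2 * q + d) * d" by (rule mult_le_mono1)
      then show ?thesis by (simp add: algebra_simps)
    qed simp
    then have "4 * card E \<le> (card V)\<^sup>2"
      using q(3) d by (simp add: power2_eq_square algebra_simps)
    then show ?thesis ..
  qed
qed

section \<open>The digraph of a saturated family and the dichotomy\<close>

text \<open>The chosen pairs form an irredundant digraph with exactly \<open>n\<close> edges, as
  each pair determines its label. The two alternatives for its size give the two terms of the
  minimum.\<close>

lemma card_ge_if_all_differences:
  assumes "finite F" "1 \<le> n"
    and diff: "\<And>i. i \<in> {1..n} \<Longrightarrow> \<exists>A\<in>F. \<exists>B\<in>F. A - B = {i}"
  shows "real (card F) \<ge> min (2 * sqrt (real n)) (real n / 2 + 1)"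
proof -
  obtain a b where ab: "\<And>i. i \<in> {1..n} \<Longrightarrow> a i \<in> F \<and> b i \<in> F \<and> a i - b i = {i}"
    using diff by metis
  define E where "E = (\<lambda>i. (a i, b i)) ` {1..n}"
  have label: "j = i" if "i \<in> {1..n}" "j \<in> {1..n}" "(a j, b j) = (a i, b i)" for i j
    using ab[of i] ab[of j] that by auto
  have "inj_on (\<lambda>i. (a i, b i)) {1..n}"
    using label by (intro inj_onI) metis
  then have cE: "card E = n"
    by (simp add: E_def card_image)
  have "irredundant E"
    unfolding irredundant_def
  proof
    fix e assume "e \<in> E"
    then obtain i where i: "i \<in> {1..n}" "e = (a i, b i)" by (auto simp: E_def)
    have survive: "i \<in> Y" if "(X, Y) \<in> (E - {e})\<^sup>*" "i \<in> X" for X Y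
      using that
    proof (induction rule: rtrancl_induct)
      case (step Y Z)
      then obtain j where j: "j \<in> {1..n}" "Y = a j" "Z = b j" "(Y, Z) \<noteq> e"
        unfolding E_def by blast
      then have "j \<noteq> i" using i(2) by auto
      with j show ?case using ab[of j] step by auto
    qed
    show "e \<notin> (E - {e})\<^sup>*"
      using survive[of "a i" "b i"] ab[OF i(1)] i(2) by auto
  qed
  moreover have "E \<subseteq> F \<times> F"
    using ab by (auto simp: E_def)
  moreover have "F \<noteq> {}"
    using ab[of 1] \<open>1 \<le> n\<close> by auto
  ultimately have bound: "n \<le> 2 * (card F - 1) \<or> 4 * n \<le> (card F)\<^sup>2"
    using card_irredundant_bound[OF assms(1)] cE by metis
  have "1 \<le> card F"
    using \<open>F \<noteq> {}\<close> assms(1) by (simp add: Suc_le_eq card_gt_0_iff)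
  from bound show ?thesis
  proof
    assume "n \<le> 2 * (card F - 1)"
    then have "n + 2 \<le> 2 * card F" using \<open>1 \<le> card F\<close> by simp
    then have "real n / 2 + 1 \<le> card F" by simp
    then show ?thesis by simp
  next
    assume "4 * n \<le> (card F)\<^sup>2"
    then have "sqrt (4 * real n) \<le> sqrt ((real (card F))\<^sup>2)"
      by (intro real_sqrt_le_mono) (metis of_nat_le_iff of_nat_mult of_nat_numeral of_nat_power)
    then have "2 * sqrt (real n) \<le> card F"
      by (simp add: real_sqrt_mult)
    then show ?thesis by simp
  qed
qed

theorem theorem1p4:
  fixes P :: "nat set set"
  assumes "set_poset P"
  shows "(\<exists>K::real. \<forall>n\<ge>1. real (sat_star n P) \<le> K) \<or>
         (\<forall>n\<ge>1. real (sat_star n P) \<ge> min (2 * sqrt (real n)) (real n / 2 + 1))"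
proof (rule disjCI)
  assume "\<not> (\<forall>n\<ge>1. real (sat_star n P) \<ge> min (2 * sqrt (real n)) (real n / 2 + 1))"
  \<comment> \<open>A single \<open>n\<close> violating the lower bound suffices: its smallest
    saturated family lacks some difference \<open>{i}\<close> and its blow-ups bound all
    cases.\<close>
  then obtain n where n: "n \<ge> 1"
    "\<not> real (sat_star n P) \<ge> min (2 * sqrt (real n)) (real n / 2 + 1)" by blast
  have "P \<noteq> {}"
    using assms by (simp add: set_poset_def)
  then obtain F where F: "induced_saturated n P F" "card F = sat_star n P"
    using sat_star_attained by blast
  have "finite F"
    using F(1) finite_subset unfolding induced_saturated_def by blast
  then obtain i where "i \<in> {1..n}" "\<And>A B. A \<in> F \<Longrightarrow> B \<in> F \<Longrightarrow> A - B \<noteq> {i}"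
    using card_ge_if_all_differences[of F n] n F(2) by metis
  then obtain K where "\<forall>N. sat_star N P \<le> K"
    using sat_star_bounded[OF F(1)] by blast
  then show "\<exists>K::real. \<forall>n\<ge>1. real (sat_star n P) \<le> K"
    by (intro exI[of _ "real K"]) simp
qed

end
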